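(* If $K\subseteq\mathbb{R}^2$ is a convex body and $\mathcal{F}$ is a family of positive homothets of $K$, then $\operatorname{vcdim}(\mathcal{F})\le 3$.
   Context: A convex body in $\mathbb{R}^n$ is a compact convex set with non-empty interior. A positive homothet of a set $S\subseteq\mathbb{R}^n$ is a set of the form $\lambda S+x$ with $\lambda>0$ and $x\in\mathbb{R}^n$. A set system $\mathcal{F}$ shatters a set of points $X$ if for every subset $X'\subseteq X$ there exists $F\in\mathcal{F}$ with $X\cap F=X'$. The VC-dimension of $\mathcal{F}$ is $\operatorname{vcdim}(\mathcal{F})=\sup\{\operatorname{card}(X) : \mathcal{F}\text{ shatters }X\}$, which is $\infty$ if there is no upper bound on the sizes of sets shattered by $\mathcal{F}$. *)

theory Defs
  imports "HOL-Analysis.Analysis" "HOL-Library.Extended_Nat"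
begin

definition convex_body :: "'a::euclidean_space set \<Rightarrow> bool" where
  "convex_body K \<longleftrightarrow> compact K \<and> convex K \<and> interior K \<noteq> {}"

definition positive_homothet :: "'a::real_vector set \<Rightarrow> 'a set \<Rightarrow> bool" where
  "positive_homothet S T \<longleftrightarrow> (\<exists>c>0. \<exists>x. T = (\<lambda>s. c *\<^sub>R s + x) ` S)"

definition shatters :: "'a set set \<Rightarrow> 'a set \<Rightarrow> bool" where
  "shatters \<F> X \<longleftrightarrow> (\<forall>X'\<subseteq>X. \<exists>F\<in>\<F>. X \<inter> F = X')"

(* card is 0 on infinite sets, so an infinite shattered set is counted explicitly
   with size \<infinity>. For the empty family no set is shattered and the supremum
   in enat is 0. *)
definition vcdim :: "'a set set \<Rightarrow> enat" where
  "vcdim \<F> = Sup {if finite X then enat (card X) else \<infinity> | X. shatters \<F> X}"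

end

theory Submission
  imports Defs
begin

text \<open>
  Suppose that four points are shattered. By Radon's theorem they split into two parts \<open>M\<close> and
  \<open>P\<close> whose convex hulls meet. If one part is a single point, this point lies in the hull of
  the other part, and no convex set can cut off that other part. So \<open>M = {a, c}\<close> and
  \<open>P = {b, d}\<close>, and the segments \<open>ac\<close> and \<open>bd\<close> meet in a point \<open>p\<close>. Two members of the family
  contain \<open>ac\<close> but neither of \<open>b\<close>, \<open>d\<close>, respectively \<open>bd\<close> but neither of \<open>a\<close>, \<open>c\<close>. Taking the
  larger of the two as the reference body \<open>K\<close>, the smaller one is \<open>h K\<close> for a map
  \<open>h v = r v + x\<close> with \<open>0 < r \<le> 1\<close>. It has to be shown that homothets cannot cross in
  this way (\<open>homothets_do_not_cross\<close>), which is a form of the pseudo-disc property of homothets in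
  the plane.

  The idea is to follow the displacement field \<open>w v = h v - v\<close>, whose lines are the rays towards the
  centre of \<open>h\<close> if \<open>r < 1\<close>, and parallels if \<open>h\<close> is a translation. Both cases are treated at
  once because \<open>w\<close> is affine in either case. No fixed point of \<open>h\<close> is in
  \<open>K\<close>, since otherwise \<open>h K \<subseteq> K\<close>. Hence \<open>K\<close> and \<open>h K\<close> meet a flow line in two intervals, the
  second one being the first one moved downstream. So a point of \<open>h K\<close> that is upstream of a point of
  \<open>K\<close> is itself in \<open>K\<close>, and a point of \<open>K\<close> that is downstream of a point of \<open>h K\<close> is itself in
  \<open>h K\<close>. As the segments \<open>ac\<close> and \<open>bd\<close> cross at \<open>p\<close>, on one of the two sides of the flow line
  through \<open>p\<close> the segment \<open>ac\<close> is upstream of \<open>bd\<close>. On that side, take the end point \<open>a\<close> of one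
  segment and \<open>b\<close> of the other. The one whose flow line is nearer to \<open>p\<close> has a flow line that meets the
  half of the other segment on this side, so either \<open>a\<close> is upstream of a point of \<open>[p, b] \<subseteq> K\<close>, or \<open>b\<close> is
  downstream of a point of \<open>[p, a] \<subseteq> h K\<close>. Both are contradictions.
  If one of the segments runs along the flow line through \<open>p\<close>, then \<open>p\<close> itself takes the role of
  the meeting point.
\<close>

section \<open>The displacement field of a homothety\<close>

definition homothety :: "real \<Rightarrow> 'a::real_vector \<Rightarrow> 'a \<Rightarrow> 'a" where
  "homothety r x v = r *\<^sub>R v + x"

definition displacement :: "real \<Rightarrow> 'a::real_vector \<Rightarrow> 'a \<Rightarrow> 'a" where
  "displacement r x v = homothety r x v - v"

lemma displacement_affine:
  "displacement r x (p + v) = displacement r x p - (1 - r) *\<^sub>R v"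
  by (simp add: displacement_def homothety_def algebra_simps)

lemma convex_homothety_image:
  assumes "convex K"
  shows "convex (homothety r x ` K)"
proof -
  have "homothety r x ` K = (\<lambda>v. x + v) ` ((\<lambda>v. r *\<^sub>R v) ` K)"
    by (auto simp: homothety_def image_image add.commute)
  then show ?thesis
    using assms by (simp add: convex_scaling convex_translation)
qed

lemma convex_mem_combination:
  assumes "convex K" "u \<in> K" "v \<in> K" "0 \<le> t" "t \<le> 1"
  shows "(1 - t) *\<^sub>R u + t *\<^sub>R v \<in> K"
  using convexD_alt[OF assms] by simp

text \<open>
  The preimage of \<open>b\<close> lies on the segment between \<open>b\<close> and the preimage of \<open>q\<close>: in terms of that
  preimage \<open>b'\<close>, the field at \<open>b'\<close> leads to \<open>b\<close>, and backwards to the preimage of \<open>q\<close>.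
\<close>

lemma downstream_mem_image:
  assumes "convex K" "b \<in> K" "q \<in> homothety r x ` K" "0 \<le> s"
    and "q = b - s *\<^sub>R displacement r x b"
  shows "b \<in> homothety r x ` K"
proof -
  obtain q' where q': "q' \<in> K" "q = homothety r x q'"
    using assms(3) by blast
  define t where "t = s / (1 + s)"
  have t: "0 \<le> t" "t \<le> 1" "t * (1 + s) = s"
    using assms(4) by (auto simp: t_def)
  have ts: "(1 - t) * (1 + s) = 1"
    using t(3) by (simp add: algebra_simps)
  have "homothety r x ((1 - t) *\<^sub>R q' + t *\<^sub>R b) = (1 - t) *\<^sub>R q + t *\<^sub>R homothety r x b"
    by (simp add: q'(2) homothety_def algebra_simps)
  also have "q = (1 + s) *\<^sub>R b - s *\<^sub>R homothety r x b"
    by (simp add: assms(5) displacement_def algebra_simps)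
  also have "(1 - t) *\<^sub>R ((1 + s) *\<^sub>R b - s *\<^sub>R homothety r x b) + t *\<^sub>R homothety r x b
      = ((1 - t) * (1 + s)) *\<^sub>R b + (t - (1 - t) * s) *\<^sub>R homothety r x b"
    by (simp add: algebra_simps)
  also have "\<dots> = b"
    using ts t(3) by (simp add: algebra_simps)
  finally show ?thesis
    using convex_mem_combination[OF assms(1) q'(1) assms(2) t(1,2)] by (metis imageI)
qed

text \<open>
  The point \<open>a\<close> lies on the segment between its preimage and \<open>q\<close>. The bound on the ratio ensures
  that the preimage is on the far side of \<open>a\<close> as seen from \<open>q\<close>.
\<close>

lemma upstream_mem:
  assumes "convex K" "a \<in> homothety r x ` K" "q \<in> K" "0 \<le> s" "0 < r" "r \<le> 1"
    and "a = q - s *\<^sub>R displacement r x q"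
  shows "a \<in> K"
proof -
  obtain a' where a': "a' \<in> K" "a = homothety r x a'"
    using assms(2) by blast
  define t where "t = s * r / (1 + s)"
  have t: "0 \<le> t" "t * (1 + s) = s * r"
    using assms(4,5) by (auto simp: t_def)
  have "s * r \<le> s"
    using assms(4,6) by (simp add: mult_left_le)
  then have "t \<le> 1"
    using assms(4) by (simp add: t_def divide_le_eq)
  have "(1 + s) *\<^sub>R ((1 - t) *\<^sub>R q + t *\<^sub>R a')
      = ((1 + s) - t * (1 + s)) *\<^sub>R q + (t * (1 + s)) *\<^sub>R a'"
    by (simp add: algebra_simps)
  also have "\<dots> = ((1 + s) - s * r) *\<^sub>R q + s *\<^sub>R (a - x)"
    by (simp add: t(2) a'(2) homothety_def)
  also have "\<dots> = (1 + s) *\<^sub>R a"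
    by (simp add: assms(7) displacement_def homothety_def algebra_simps)
  finally have "(1 - t) *\<^sub>R q + t *\<^sub>R a' = a"
    using assms(4) by (simp add: scaleR_cancel_left)
  then show ?thesis
    using convex_mem_combination[OF assms(1,3) a'(1) t(1) \<open>t \<le> 1\<close>] by simp
qed

text \<open>The image of a point lies between this point and the centre.\<close>

lemma image_subset_if_fixed_point:
  assumes "convex K" "z \<in> K" "displacement r x z = 0" "0 < r" "r \<le> 1"
  shows "homothety r x ` K \<subseteq> K"
proof -
  have x: "x = (1 - r) *\<^sub>R z"
    using assms(3) by (simp add: displacement_def homothety_def algebra_simps)
  have "(1 - r) *\<^sub>R z + r *\<^sub>R v \<in> K" if "v \<in> K" for v
    using convex_mem_combination[OF assms(1,2) that] assms(4,5) by simp
  then show ?thesis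
    by (auto simp: homothety_def x add.commute)
qed

section \<open>Crossing segments\<close>

text \<open>
  In the coordinates in which \<open>p\<close> is the origin and \<open>w\<close>, the field at \<open>p\<close>, and \<open>f\<close> are the axes,
  a larger slope parameter means further upstream. This is one side of the flow line through
  \<open>p\<close>, where \<open>[p, a]\<close> is upstream of \<open>[p, b]\<close>.
\<close>

lemma upstream_side_contradiction:
  assumes K: "convex K" and r: "0 < r" "r \<le> 1"
    and a: "a \<in> homothety r x ` K" "a \<notin> K"
    and b: "b \<in> K" "b \<notin> homothety r x ` K"
    and p: "p \<in> K" "p \<in> homothety r x ` K"
    and w: "w = displacement r x p"
    and ac: "a = p + t *\<^sub>R (f - m *\<^sub>R w)" "0 \<le> t"
    and bd: "b = p + u *\<^sub>R (f - n *\<^sub>R w)" "0 \<le> u"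
    and le: "n \<le> m"
  shows False
proof -
  define k where "k = (1 - r) * (m - n)"
  have k: "0 \<le> k" using r le by (simp add: k_def)
  have field: "displacement r x (p + v) = w - (1 - r) *\<^sub>R v" for v
    by (simp add: w displacement_affine)
  \<comment> \<open>Whether the flow line of \<open>a\<close> is nearer to \<open>p\<close> than that of \<open>b\<close>.\<close>
  show False
  proof (cases "t \<le> u * (1 + k * t)")
    case True
    \<comment> \<open>The flow line of \<open>a\<close> meets \<open>[p, b]\<close> in \<open>q\<close>.\<close>
    have pos: "0 < 1 + k * t" using k ac(2) by (simp add: add_pos_nonneg)
    define y where "y = t / (1 + k * t)"
    define s where "s = (m - n) * t"
    define q where "q = p + y *\<^sub>R (f - n *\<^sub>R w)"
    have y: "0 \<le> y" "y \<le> u" "y * (1 + k * t) = t"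
      using True pos ac(2) by (auto simp: y_def divide_le_eq)
    have s: "0 \<le> s" using le ac(2) by (simp add: s_def)
    have "q \<in> K"
    proof (cases "u = 0")
      case True
      then show ?thesis using y p by (simp add: q_def)
    next
      case False
      then have "q = (1 - y / u) *\<^sub>R p + (y / u) *\<^sub>R b"
        by (simp add: q_def bd(1) algebra_simps)
      then show ?thesis
        using convex_mem_combination[OF K p(1) b(1), of "y / u"] y bd(2) False by simp
    qed
    have "q - s *\<^sub>R displacement r x q
        = p + (y * (1 + (1 - r) * s)) *\<^sub>R (f - n *\<^sub>R w) - s *\<^sub>R w"
      unfolding q_def field by (simp add: algebra_simps)
    also have "y * (1 + (1 - r) * s) = t"
      using y(3) by (simp add: s_def k_def mult.assoc)
    also have "p + t *\<^sub>R (f - n *\<^sub>R w) - s *\<^sub>R w = a"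
      by (simp add: ac(1) s_def algebra_simps)
    finally show False
      using upstream_mem[OF K a(1) \<open>q \<in> K\<close> s r] a(2) by simp
  next
    case False
    \<comment> \<open>The flow line of \<open>b\<close> meets \<open>[p, a]\<close> in \<open>q\<close>.\<close>
    then have less: "u < t * (1 - k * u)" by (simp add: algebra_simps)
    then have pos: "0 < 1 - k * u" and "0 < t"
      using ac(2) bd(2) by (smt (verit) mult_nonneg_nonpos mult_eq_0_iff)+
    define y where "y = u / (1 - k * u)"
    define s where "s = (m - n) * y"
    define q where "q = p + y *\<^sub>R (f - m *\<^sub>R w)"
    have y: "0 \<le> y" "y \<le> t" "y * (1 - k * u) = u"
      using less pos bd(2) by (auto simp: y_def divide_le_eq)
    have s: "0 \<le> s" using le y(1) by (simp add: s_def)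
    have "q = (1 - y / t) *\<^sub>R p + (y / t) *\<^sub>R a"
      using \<open>0 < t\<close> by (simp add: q_def ac(1) algebra_simps)
    then have q: "q \<in> homothety r x ` K"
      using convex_mem_combination[OF convex_homothety_image[OF K] p(2) a(1), of "y / t"]
        y \<open>0 < t\<close> by simp
    have "b - s *\<^sub>R displacement r x b
        = p + (u + (1 - r) * s * u) *\<^sub>R (f - n *\<^sub>R w) - s *\<^sub>R w"
      unfolding bd(1) field by (simp add: algebra_simps)
    also have "u + (1 - r) * s * u = y"
      using y(3) by (simp add: s_def k_def algebra_simps)
    also have "p + y *\<^sub>R (f - n *\<^sub>R w) - s *\<^sub>R w = q"
      by (simp add: q_def s_def algebra_simps)
    finally show False
      using downstream_mem_image[OF K b(1) q s] b(2) by simp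
  qed
qed

text \<open>
  If \<open>b\<close> is on the flow line through \<open>p\<close>, its field can vanish or point backwards only if the
  segment \<open>[p, b]\<close> contains a fixed point.
\<close>

lemma downstream_of_common_point_contradiction:
  assumes K: "convex K" and r: "0 < r" "r \<le> 1"
    and not_sub: "\<not> homothety r x ` K \<subseteq> K"
    and b: "b \<in> K" "b \<notin> homothety r x ` K"
    and p: "p \<in> K" "p \<in> homothety r x ` K"
    and bp: "b = p + i *\<^sub>R displacement r x p" "0 \<le> i"
  shows False
proof (cases "0 < 1 - (1 - r) * i")
  case True
  define w where "w = displacement r x p"
  define s where "s = i / (1 - (1 - r) * i)"
  have s: "0 \<le> s" "s * (1 - (1 - r) * i) = i"
    using True bp(2) by (auto simp: s_def)
  have "displacement r x b = (1 - (1 - r) * i) *\<^sub>R w"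
    by (simp add: bp(1) displacement_affine w_def[symmetric] algebra_simps)
  then have "b - s *\<^sub>R displacement r x b = p + i *\<^sub>R w - (s * (1 - (1 - r) * i)) *\<^sub>R w"
    by (simp add: bp(1) w_def[symmetric])
  then have "p = b - s *\<^sub>R displacement r x b"
    by (simp add: s(2))
  then show False
    using downstream_mem_image[OF K b(1) p(2) s(1)] b(2) by simp
next
  case False
  define j where "j = 1 / (1 - r)"
  have "r \<noteq> 1" using False by auto
  then have r1: "0 < 1 - r" using r by simp
  have j: "0 < j" "(1 - r) * j = 1" using r1 by (auto simp: j_def)
  have "j \<le> i" using False r1 by (simp add: j_def divide_le_eq mult.commute)
  then have i: "0 < i" using j by simp
  define z where "z = p + j *\<^sub>R displacement r x p"
  have "z = (1 - j / i) *\<^sub>R p + (j / i) *\<^sub>R b"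
    using i by (simp add: z_def bp(1) algebra_simps)
  then have "z \<in> K"
    using convex_mem_combination[OF K p(1) b(1), of "j / i"] i j \<open>j \<le> i\<close> by simp
  moreover have "displacement r x z = 0"
    using j(2) by (simp add: z_def displacement_affine)
  ultimately show False
    using image_subset_if_fixed_point[OF K _ _ r] not_sub by blast
qed

text \<open>
  Either the segment runs along the flow line through \<open>p\<close>, or \<open>p\<close> cuts it into two halves of the
  same slope on opposite sides of this flow line. An end point may coincide with \<open>p\<close>, which is why
  the inequalities are weak.
\<close>

lemma segment_through_in_coordinates:
  fixes p w f :: "'a::real_vector"
  assumes "p \<in> closed_segment a c"
    and basis: "\<And>v. \<exists>i j. v = i *\<^sub>R w + j *\<^sub>R f"
  shows "(\<exists>i\<ge>0. \<exists>i'\<le>0. {a, c} = {p + i *\<^sub>R w, p + i' *\<^sub>R w}) \<or>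
    (\<exists>m. \<exists>t\<ge>0. \<exists>t'\<le>0. {a, c} = {p + t *\<^sub>R (f - m *\<^sub>R w), p + t' *\<^sub>R (f - m *\<^sub>R w)})"
proof -
  obtain \<mu> where \<mu>: "0 \<le> \<mu>" "\<mu> \<le> 1" "p = (1 - \<mu>) *\<^sub>R a + \<mu> *\<^sub>R c"
    using assms(1) by (auto simp: in_segment)
  obtain i j where ij: "c - a = i *\<^sub>R w + j *\<^sub>R f"
    using basis by blast
  have sym: "\<exists>t\<ge>0. \<exists>t'\<le>0. {a, c} = {p + t *\<^sub>R g, p + t' *\<^sub>R g}" if "c - a = l *\<^sub>R g" for l g
  proof -
    have "a = p - \<mu> *\<^sub>R (c - a)" "c = p + (1 - \<mu>) *\<^sub>R (c - a)"
      by (simp_all add: \<mu>(3) algebra_simps)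
    then have ac: "a = p + (- \<mu> * l) *\<^sub>R g" "c = p + ((1 - \<mu>) * l) *\<^sub>R g"
      using that by simp_all
    show ?thesis
    proof (cases "0 \<le> l")
      case True
      then have "0 \<le> (1 - \<mu>) * l" "- \<mu> * l \<le> 0" using \<mu> by auto
      then show ?thesis using ac by (metis insert_commute)
    next
      case False
      then have "(1 - \<mu>) * l \<le> 0" "0 \<le> - \<mu> * l"
        using \<mu> by (auto simp: mult_nonneg_nonpos mult_nonneg_nonneg)
      then show ?thesis using ac by metis
    qed
  qed
  show ?thesis
  proof (cases "j = 0")
    case True
    then show ?thesis using sym[of i w] ij by simp
  next
    case False
    then have "c - a = j *\<^sub>R (f - (- i / j) *\<^sub>R w)"
      using ij by (simp add: algebra_simps)
    then show ?thesis using sym by blast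
  qed
qed

lemma plane_basis:
  fixes w :: "real ^ 2"
  assumes "w \<noteq> 0"
  shows "\<exists>f. \<forall>v. \<exists>i j. v = i *\<^sub>R w + j *\<^sub>R f"
proof -
  define N where "N = w $ 1 * w $ 1 + w $ 2 * w $ 2"
  have N: "N \<noteq> 0"
    using assms by (auto simp: N_def vec_eq_iff forall_2 sum_squares_eq_zero_iff)
  define f :: "real ^ 2" where "f = vector [- w $ 2, w $ 1]"
  have "v = ((v $ 1 * w $ 1 + v $ 2 * w $ 2) / N) *\<^sub>R w + ((v $ 2 * w $ 1 - v $ 1 * w $ 2) / N) *\<^sub>R f"
    for v
  proof -
    have "v $ 1 * N = (v $ 1 * w $ 1 + v $ 2 * w $ 2) * w $ 1 - (v $ 2 * w $ 1 - v $ 1 * w $ 2) * w $ 2"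
      "v $ 2 * N = (v $ 1 * w $ 1 + v $ 2 * w $ 2) * w $ 2 + (v $ 2 * w $ 1 - v $ 1 * w $ 2) * w $ 1"
      by (simp_all add: N_def algebra_simps)
    then show ?thesis
      using N by (simp add: vec_eq_iff forall_2 f_def vector_2 field_simps)
  qed
  then show ?thesis by blast
qed

text \<open>
  Which of the two segments has the larger slope parameter decides on which side of the flow line
  through \<open>p\<close> the segment from \<open>a\<close> to \<open>c\<close> is the upstream one.
\<close>

lemma homothets_do_not_cross_contracting:
  fixes K :: "(real ^ 2) set"
  assumes K: "convex K" and r: "0 < r" "r \<le> 1"
    and a: "a \<in> homothety r x ` K - K" and c: "c \<in> homothety r x ` K - K"
    and b: "b \<in> K - homothety r x ` K" and d: "d \<in> K - homothety r x ` K"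
    and p: "p \<in> closed_segment a c" "p \<in> closed_segment b d"
  shows False
proof -
  define w where "w = displacement r x p"
  have pK: "p \<in> K"
    using p(2) b d closed_segment_subset[OF _ _ K] by blast
  have pH: "p \<in> homothety r x ` K"
    using p(1) a c closed_segment_subset[OF _ _ convex_homothety_image[OF K]] by blast
  have not_sub: "\<not> homothety r x ` K \<subseteq> K" using a by blast
  then have "w \<noteq> 0"
    using image_subset_if_fixed_point[OF K pK _ r, of x] by (auto simp: w_def)
  then obtain f where f: "\<exists>i j. v = i *\<^sub>R w + j *\<^sub>R f" for v
    using plane_basis by blast
  have on_line_ac: "v \<in> homothety r x ` K - K" if "v \<in> {a, c}" for v using that a c by blast
  have on_line_bd: "v \<in> K - homothety r x ` K" if "v \<in> {b, d}" for v using that b d by blast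
  from segment_through_in_coordinates[OF p(1) f] show False
  proof (elim disjE exE conjE)
    fix i i' :: real
    assume "i' \<le> 0" "{a, c} = {p + i *\<^sub>R w, p + i' *\<^sub>R w}"
    then have "p + i' *\<^sub>R w \<in> homothety r x ` K - K" using on_line_ac by blast
    then show False
      using upstream_mem[OF K _ pK _ r, of "p + i' *\<^sub>R w" x "- i'"] \<open>i' \<le> 0\<close>
      by (simp add: w_def)
  next
    fix m t t' :: real
    assume t: "0 \<le> t" "t' \<le> 0"
      and ac: "{a, c} = {p + t *\<^sub>R (f - m *\<^sub>R w), p + t' *\<^sub>R (f - m *\<^sub>R w)}"
    from segment_through_in_coordinates[OF p(2) f] show False
    proof (elim disjE exE conjE)
      fix i i' :: real
      assume "0 \<le> i" "{b, d} = {p + i *\<^sub>R w, p + i' *\<^sub>R w}"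
      then have "p + i *\<^sub>R w \<in> K - homothety r x ` K" using on_line_bd by blast
      then show False
        using downstream_of_common_point_contradiction[OF K r not_sub _ _ pK pH _ \<open>0 \<le> i\<close>]
        by (simp add: w_def)
    next
      fix n u u' :: real
      assume u: "0 \<le> u" "u' \<le> 0"
        and bd: "{b, d} = {p + u *\<^sub>R (f - n *\<^sub>R w), p + u' *\<^sub>R (f - n *\<^sub>R w)}"
      show False
      proof (cases "n \<le> m")
        case True
        show False
          by (rule upstream_side_contradiction[OF K r _ _ _ _ pK pH w_def refl t(1) refl u(1) True])
            (use on_line_ac on_line_bd ac bd in blast)+
      next
        case False
        \<comment> \<open>On the other side of the flow line through \<open>p\<close>, which \<open>- f\<close> points to, the slope
            parameters change their sign.\<close>
        have neg: "p + y *\<^sub>R (f - l *\<^sub>R w) = p + (- y) *\<^sub>R (- f - (- l) *\<^sub>R w)" for y l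
          by (simp add: algebra_simps)
        have "p + t' *\<^sub>R (f - m *\<^sub>R w) \<in> homothety r x ` K - K"
          "p + u' *\<^sub>R (f - n *\<^sub>R w) \<in> K - homothety r x ` K"
          using on_line_ac on_line_bd ac bd by blast+
        then show False
          using upstream_side_contradiction[OF K r _ _ _ _ pK pH w_def neg _ neg] t(2) u(2) False
          by force
      qed
    qed
  qed
qed

section \<open>Shattered sets\<close>

lemma positive_homothet_relative:
  assumes "positive_homothet K F" "positive_homothet K G"
  obtains r x where "0 < r" "r \<le> 1" "F = homothety r x ` G"
  | r x where "0 < r" "r \<le> 1" "G = homothety r x ` F"
proof -
  have rel: "\<exists>x. (\<lambda>s. c *\<^sub>R s + y) ` K = homothety (c / e) x ` (\<lambda>s. e *\<^sub>R s + z) ` K"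
    if "0 < e" for c e :: real and y z :: 'a
  proof -
    have "c *\<^sub>R s + y = homothety (c / e) (y - (c / e) *\<^sub>R z) (e *\<^sub>R s + z)" for s
      using that by (simp add: homothety_def algebra_simps)
    then show ?thesis by (metis (no_types, lifting) image_cong image_image)
  qed
  obtain c y where F: "0 < c" "F = (\<lambda>s. c *\<^sub>R s + y) ` K"
    using assms(1) by (auto simp: positive_homothet_def)
  obtain e z where G: "0 < e" "G = (\<lambda>s. e *\<^sub>R s + z) ` K"
    using assms(2) by (auto simp: positive_homothet_def)
  show ?thesis
  proof (cases "c \<le> e")
    case True
    then have "0 < c / e" "c / e \<le> 1" using F G by auto
    then show ?thesis using rel[OF G(1), of c y z] that(1) F G by blast
  next
    case False
    then have "0 < e / c" "e / c \<le> 1" using F G by auto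
    then show ?thesis using rel[OF F(1), of e z y] that(2) F G by blast
  qed
qed

lemma convex_positive_homothet:
  assumes "convex K" "positive_homothet K F"
  shows "convex F"
proof -
  obtain c x where "F = homothety c x ` K"
    using assms(2) by (auto simp: positive_homothet_def homothety_def)
  then show ?thesis using convex_homothety_image[OF assms(1)] by simp
qed

lemma homothets_do_not_cross:
  fixes K :: "(real ^ 2) set"
  assumes "convex K" "positive_homothet K F" "positive_homothet K G"
    and "a \<in> F - G" "c \<in> F - G" "b \<in> G - F" "d \<in> G - F"
  shows "closed_segment a c \<inter> closed_segment b d = {}"
proof (rule ccontr)
  assume "closed_segment a c \<inter> closed_segment b d \<noteq> {}"
  then obtain p where p: "p \<in> closed_segment a c" "p \<in> closed_segment b d" by blast
  note conv = convex_positive_homothet[OF assms(1,2)] convex_positive_homothet[OF assms(1,3)]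
  from assms(2,3) show False
  proof (cases rule: positive_homothet_relative)
    case (1 r x)
    show False
      by (rule homothets_do_not_cross_contracting[OF conv(2) 1(1,2) _ _ _ _ p]) (use assms 1 in auto)
  next
    case (2 r x)
    show False
      by (rule homothets_do_not_cross_contracting[OF conv(1) 2(1,2) _ _ _ _ p(2,1)])
        (use assms 2 in auto)
  qed
qed

lemma shatters_subset:
  assumes "shatters \<F> X" "Y \<subseteq> X"
  shows "shatters \<F> Y"
  unfolding shatters_def
proof (intro allI impI)
  fix Z assume Z: "Z \<subseteq> Y"
  then obtain F where "F \<in> \<F>" "X \<inter> F = Z"
    using assms unfolding shatters_def by (meson order_trans)
  then show "\<exists>F\<in>\<F>. Y \<inter> F = Z" using Z assms(2) by blast
qed

lemma no_four_points_shattered: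
  fixes K :: "(real ^ 2) set"
  assumes K: "convex K"
    and hom: "\<And>F. F \<in> \<F> \<Longrightarrow> positive_homothet K F"
    and Y: "shatters \<F> Y" "card Y = 4"
  shows False
proof -
  have fin: "finite Y" using Y(2) by (metis card.infinite zero_neq_numeral)
  have "affine_dependent Y"
    by (rule affine_dependent_biggerset[OF fin]) (simp add: Y(2))
  then obtain M P where MP: "M \<inter> P = {}" "M \<union> P = Y" "convex hull M \<inter> convex hull P \<noteq> {}"
    using Radon_partition[OF fin] by blast
  then have finMP: "finite M" "finite P" and card: "card M + card P = 4"
    using fin Y(2) card_Un_disjoint[of M P] by (metis finite_Un)+
  have cut: "\<exists>F. positive_homothet K F \<and> Y \<inter> F = Z" if "Z \<subseteq> Y" for Z
    using that Y(1) hom unfolding shatters_def by blast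
  have not_single: "card A \<noteq> 1" if "A \<inter> B = {}" "A \<union> B = Y" "convex hull A \<inter> convex hull B \<noteq> {}"
    for A B
  proof
    assume "card A = 1"
    then obtain v where v: "A = {v}" by (auto simp: card_1_singleton_iff)
    obtain F where F: "positive_homothet K F" "Y \<inter> F = B"
      using cut[of B] \<open>A \<union> B = Y\<close> by blast
    then have "convex hull B \<subseteq> F"
      using convex_positive_homothet[OF K] by (metis hull_minimal inf_le2)
    then have "v \<in> F" using that(3) v by auto
    then show False using F that v by blast
  qed
  have "card M \<noteq> 1" "card P \<noteq> 1"
    using not_single[of M P] not_single[of P M] MP by (auto simp: Un_commute Int_commute)
  moreover have "card M \<noteq> 0" "card P \<noteq> 0" using MP(3) finMP by auto
  ultimately have "card M = 2" "card P = 2" using card by linarith+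
  then obtain a c b d where acbd: "M = {a, c}" "P = {b, d}" by (auto simp: card_2_iff)
  obtain F where F: "positive_homothet K F" "Y \<inter> F = M" using cut MP(2) by blast
  obtain G where G: "positive_homothet K G" "Y \<inter> G = P" using cut MP(2) by blast
  have "closed_segment a c \<inter> closed_segment b d = {}"
    by (rule homothets_do_not_cross[OF K F(1) G(1)]) (use F G MP acbd in blast)+
  then show False using MP(3) by (simp add: acbd segment_convex_hull)
qed

theorem theorem3:
  fixes K :: "(real ^ 2) set" and \<F> :: "(real ^ 2) set set"
  assumes "convex_body K"
    and "\<And>F. F \<in> \<F> \<Longrightarrow> positive_homothet K F"
  shows "vcdim \<F> \<le> 3"
proof -
  have K: "convex K" using assms(1) by (simp add: convex_body_def)
  have "finite X \<and> card X \<le> 3" if "shatters \<F> X" for X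
  proof (rule ccontr)
    assume "\<not> (finite X \<and> card X \<le> 3)"
    then have "infinite X \<or> 4 \<le> card X" by auto
    then obtain Y where "Y \<subseteq> X" "card Y = 4"
      by (metis infinite_arbitrarily_large obtain_subset_with_card_n)
    then show False
      using no_four_points_shattered[OF K assms(2)] shatters_subset[OF that] by blast
  qed
  then have "(if finite X then enat (card X) else \<infinity>) \<le> 3" if "shatters \<F> X" for X
    using that by (simp add: numeral_eq_enat)
  then show ?thesis
    unfolding vcdim_def by (intro Sup_least) blast
qed

end
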